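(* Let $f_1$ and $f_2$ be two functions of class $\mathcal{P}$ (defined in the context). Then the function $$m(x)=\min\{f_1(x),f_2(x)\},\qquad x\in\mathbb{R},$$ is again a continuous, nondecreasing, piecewise linear function of $x$ of class $\mathcal{P}$.
   Context: A function $f:\mathbb{R}\to\mathbb{R}$ is of class $\mathcal{P}$ if it is continuous, nondecreasing and piecewise linear with a finite number $M\ge1$ of changes of slope, at abscissae $\gamma_1<\gamma_2<\dots<\gamma_M$, having slope $\mu_0$ on $(-\infty,\gamma_1)$, $\mu_i$ on $[\gamma_i,\gamma_{i+1})$ for $i=1,\dots,M-1$, and $\mu_M$ on $[\gamma_M,+\infty)$, with $\mu_{i+1}\ne\mu_i$ for all $i=0,\dots,M-1$, and if moreover $f(x)=0$ for every $x\le\gamma_1$ (so $\mu_0=0$). *)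

theory Defs
  imports Complex_Main
begin

definition has_slope_on :: "(real \<Rightarrow> real) \<Rightarrow> real \<Rightarrow> real set \<Rightarrow> bool" where
  "has_slope_on f s S \<longleftrightarrow> (\<exists>c. \<forall>x\<in>S. f x = s * x + c)"

text \<open>
  The abscissae are \<open>\<gamma> 1, \<dots>, \<gamma> M\<close> and the slopes \<open>\<mu> 0, \<dots>, \<mu> M\<close>;
  the values of \<open>\<gamma>\<close> and \<open>\<mu>\<close> at other indices are irrelevant.
\<close>

definition piecewise_linear_with ::
    "(real \<Rightarrow> real) \<Rightarrow> nat \<Rightarrow> (nat \<Rightarrow> real) \<Rightarrow> (nat \<Rightarrow> real) \<Rightarrow> bool" where
  "piecewise_linear_with f M \<gamma> \<mu> \<longleftrightarrow>
     M \<ge> 1 \<and>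
     strict_mono_on {1..M} \<gamma> \<and>
     has_slope_on f (\<mu> 0) {..<\<gamma> 1} \<and>
     (\<forall>i\<in>{1..<M}. has_slope_on f (\<mu> i) {\<gamma> i..<\<gamma> (i + 1)}) \<and>
     has_slope_on f (\<mu> M) {\<gamma> M..} \<and>
     (\<forall>i<M. \<mu> (i + 1) \<noteq> \<mu> i)"

definition class_P :: "(real \<Rightarrow> real) \<Rightarrow> bool" where
  "class_P f \<longleftrightarrow>
     continuous_on UNIV f \<and> mono f \<and>
     (\<exists>M \<gamma> \<mu>. piecewise_linear_with f M \<gamma> \<mu> \<and> (\<forall>x\<le>\<gamma> 1. f x = 0))"

end

theory Submission
  imports Defs "HOL-Analysis.Analysis"
begin

text \<open>
  Membership in class \<open>\<P>\<close> is characterized without enumerating breakpoints: a continuous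
  nondecreasing function is of class \<open>\<P>\<close> iff it vanishes near \<open>-\<infinity>\<close>, is not identically zero
  and is locally affine outside a finite set. The last property passes to the minimum, because
  between two consecutive breakpoints of \<open>f\<close> or \<open>g\<close> both functions are affine, so that their
  graphs cross at most once there.
\<close>

section \<open>Local affine formulas and break points\<close>

text \<open>The pair \<open>p\<close> holds slope and intercept. Since \<open>nhds x\<close> takes
  \<open>x\<close> itself into account, the formula also fixes the value at
  \<open>x\<close>.\<close>

definition affine_near :: "(real \<Rightarrow> real) \<Rightarrow> real \<Rightarrow> real \<times> real \<Rightarrow> bool" where
  "affine_near f x p \<longleftrightarrow> (\<forall>\<^sub>F y in nhds x. f y = fst p * y + snd p)"

text \<open>An intrinsic substitute for the abscissae, free of any choice of \<open>M\<close>,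
  \<open>\<gamma>\<close> and \<open>\<mu>\<close>.\<close>

definition breaks :: "(real \<Rightarrow> real) \<Rightarrow> real set" where
  "breaks f = {x. \<nexists>p. affine_near f x p}"

lemma affine_coeffs_eqI:
  fixes s t c d x y :: real
  assumes "s * x + c = t * x + d" and "s * y + c = t * y + d" and "x \<noteq> y"
  shows "s = t \<and> c = d"
proof -
  have "(s - t) * (x - y) = 0"
    using assms by (simp add: algebra_simps)
  then show ?thesis using assms by simp
qed

text \<open>A neighbourhood of \<open>x\<close> contains a second point, and two points determine a
  line.\<close>

lemma affine_near_unique:
  assumes "affine_near f x p" and "affine_near f x q"
  shows "p = q"
proof -
  have "\<forall>\<^sub>F y in nhds x. fst p * y + snd p = fst q * y + snd q"
    using assms unfolding affine_near_def by eventually_elim simp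
  then obtain S where S: "open S" "x \<in> S" "\<And>y. y \<in> S \<Longrightarrow> fst p * y + snd p = fst q * y + snd q"
    unfolding eventually_nhds by blast
  obtain e where e: "e > 0" "ball x e \<subseteq> S"
    using S openE by blast
  then have "x + e / 2 \<in> S"
    by (auto simp: dist_real_def subset_iff)
  then show ?thesis
    using affine_coeffs_eqI[of "fst p" x "snd p" "fst q" "snd q" "x + e / 2"] S e
    by (simp add: prod_eq_iff)
qed

lemma affine_near_eventually:
  assumes "affine_near f x p"
  shows "\<forall>\<^sub>F y in nhds x. affine_near f y p"
  using assms unfolding affine_near_def by (subst eventually_eventually)

lemma affine_near_value: "affine_near f x p \<Longrightarrow> f x = fst p * x + snd p"
  unfolding affine_near_def by (rule eventually_nhds_x_imp_x)

text \<open>By uniqueness the coefficients chosen by \<open>SOME\<close> are locally constant, hence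
  constant on a connected set.\<close>

lemma affine_near_connected:
  assumes A: "connected A" and disj: "A \<inter> breaks f = {}"
  obtains p where "\<And>x. x \<in> A \<Longrightarrow> affine_near f x p"
proof -
  define h where "h x = (SOME p. affine_near f x p)" for x
  have h: "affine_near f x (h x)" if "x \<in> A" for x
  proof -
    have "\<exists>p. affine_near f x p"
      using that disj unfolding breaks_def by auto
    then show ?thesis
      unfolding h_def by (rule someI_ex)
  qed
  have loc: "\<forall>a\<in>A. \<forall>\<^sub>F b in at a within A. h a = h b"
  proof
    fix a assume a: "a \<in> A"
    from affine_near_eventually[OF h[OF a]]
    show "\<forall>\<^sub>F b in at a within A. h a = h b"
      unfolding eventually_at_filter
      by eventually_elim (use h affine_near_unique in blast)
  qed
  show ?thesis
  proof (cases "A = {}")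
    case True
    then show ?thesis using that by auto
  next
    case False
    then obtain a where a: "a \<in> A" by blast
    show ?thesis
    proof (rule that[of "h a"])
      fix x assume x: "x \<in> A"
      then show "affine_near f x (h a)"
        using h[OF x] connected_local_const[OF A a x loc] by simp
    qed
  qed
qed

section \<open>Breaks of a minimum\<close>

text \<open>If the values differ at \<open>x\<close>, the strict inequality between the two lines
  persists nearby and the minimum follows the lower line; if the coefficients coincide, it follows
  the common line. Either way \<open>x\<close> would be no break.\<close>

lemma breaks_minD:
  assumes "x \<in> breaks (\<lambda>x. min (f x) (g x))"
    and f: "affine_near f x p" and g: "affine_near g x q"
  shows "f x = g x" and "p \<noteq> q"
proof -
  let ?m = "\<lambda>x. min (f x) (g x)"
  have nb: "\<not> affine_near ?m x r" for r
    using assms(1) unfolding breaks_def by blast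
  have lt: "\<forall>\<^sub>F y in nhds x. fst r * y + snd r < fst r' * y + snd r'"
    if "fst r * x + snd r < fst r' * x + snd r'" for r r' :: "real \<times> real"
  proof -
    have "open {y. fst r * y + snd r < fst r' * y + snd r'}"
      by (intro open_Collect_less continuous_intros)
    then show ?thesis
      using that unfolding eventually_nhds by blast
  qed
  show "f x = g x"
  proof (rule ccontr)
    assume "f x \<noteq> g x"
    then consider "f x < g x" | "g x < f x" by linarith
    then show False
    proof cases
      case 1
      then have "fst p * x + snd p < fst q * x + snd q"
        using f g by (simp add: affine_near_value)
      from lt[OF this] f g have "affine_near ?m x p"
        unfolding affine_near_def by eventually_elim simp
      then show False using nb by blast
    next
      case 2
      then have "fst q * x + snd q < fst p * x + snd p"
        using f g by (simp add: affine_near_value)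
      from lt[OF this] f g have "affine_near ?m x q"
        unfolding affine_near_def by eventually_elim simp
      then show False using nb by blast
    qed
  qed
  show "p \<noteq> q"
  proof
    assume "p = q"
    with f g have "affine_near ?m x p"
      unfolding affine_near_def by (auto elim: eventually_elim2)
    then show False using nb by blast
  qed
qed

text \<open>A break of the minimum outside \<open>?K\<close> is a crossing of two distinct lines.
  Two of them in the same gap of \<open>?K\<close> would make the same two lines cross
  twice.\<close>

lemma finite_breaks_min:
  assumes "finite (breaks f)" and "finite (breaks g)"
  shows "finite (breaks (\<lambda>x. min (f x) (g x)))"
proof -
  let ?B = "breaks (\<lambda>x. min (f x) (g x))" and ?K = "breaks f \<union> breaks g"
  \<comment> \<open>\<open>\<phi> x\<close> encodes the gap of \<open>?K\<close> containing
    \<open>x\<close>. It takes values in the finite set \<open>Pow ?K\<close>, so injectivity on the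
    new breaks makes them finite in number.\<close>
  define \<phi> where "\<phi> x = {k \<in> ?K. k < x}" for x
  have less: "\<phi> x \<noteq> \<phi> y" if x: "x \<in> ?B - ?K" and y: "y \<in> ?B - ?K" and "x < y" for x y
  proof
    assume eq: "\<phi> x = \<phi> y"
    have "k \<notin> {x..y}" if k: "k \<in> ?K" for k
    proof
      assume "k \<in> {x..y}"
      moreover have "k \<noteq> x" "k \<noteq> y" using k x y by auto
      ultimately have "k \<in> \<phi> y" "k \<notin> \<phi> x" using k by (auto simp: \<phi>_def)
      with eq show False by simp
    qed
    then have disj: "{x..y} \<inter> breaks f = {}" "{x..y} \<inter> breaks g = {}" by blast+
    obtain p where p: "\<And>z. z \<in> {x..y} \<Longrightarrow> affine_near f z p"
      using affine_near_connected[OF connected_Icc disj(1)] by blast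
    obtain q where q: "\<And>z. z \<in> {x..y} \<Longrightarrow> affine_near g z q"
      using affine_near_connected[OF connected_Icc disj(2)] by blast
    have in_xy: "x \<in> {x..y}" "y \<in> {x..y}" using \<open>x < y\<close> by auto
    have "f x = g x" "f y = g y" "p \<noteq> q"
      using breaks_minD[of x f g p q] breaks_minD[of y f g p q] x y p q in_xy by auto
    moreover have "f x = fst p * x + snd p" "f y = fst p * y + snd p"
      "g x = fst q * x + snd q" "g y = fst q * y + snd q"
      using p q in_xy affine_near_value by blast+
    ultimately show False
      using affine_coeffs_eqI[of "fst p" x "snd p" "fst q" "snd q" y] \<open>x < y\<close>
      by (auto simp: prod_eq_iff)
  qed
  have "inj_on \<phi> (?B - ?K)"
    by (rule inj_onI) (metis less linorder_neqE_linordered_idom)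
  moreover have "finite (\<phi> ` (?B - ?K))"
    by (rule finite_subset[of _ "Pow ?K"]) (use assms in \<open>auto simp: \<phi>_def\<close>)
  ultimately have "finite (?B - ?K)"
    by (rule finite_imageD[rotated])
  then show ?thesis
    using assms by simp
qed

section \<open>From abscissae to break sets and back\<close>

lemma finite_strict_mono_enumeration:
  fixes A :: "'a::linorder set"
  assumes "finite A"
  obtains \<gamma> where "strict_mono_on {1..card A} \<gamma>" and "\<gamma> ` {1..card A} = A"
proof
  let ?xs = "sorted_list_of_set A"
  \<comment> \<open>List positions start at 0, abscissae at 1.\<close>
  define \<gamma> where "\<gamma> i = ?xs ! (i - 1)" for i
  show "strict_mono_on {1..card A} \<gamma>"
  proof (rule strict_mono_onI)
    fix i j assume ij: "i \<in> {1..card A}" "j \<in> {1..card A}" "i < j"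
    show "\<gamma> i < \<gamma> j"
      unfolding \<gamma>_def
      by (rule sorted_wrt_nth_less[OF strict_sorted_list_of_set])
        (use ij assms in auto)
  qed
  have "set ?xs = {?xs ! i |i. i < card A}"
    using assms by (simp add: set_conv_nth)
  also have "\<dots> = \<gamma> ` {1..card A}"
  proof (intro equalityI subsetI)
    fix x assume "x \<in> {?xs ! i |i. i < card A}"
    then obtain i where "x = \<gamma> (Suc i)" "i < card A" by (auto simp: \<gamma>_def)
    then show "x \<in> \<gamma> ` {1..card A}" by auto
  next
    fix x assume "x \<in> \<gamma> ` {1..card A}"
    then obtain i where "i \<in> {1..card A}" "x = ?xs ! (i - 1)" by (auto simp: \<gamma>_def)
    then show "x \<in> {?xs ! i |i. i < card A}" by force
  qed
  finally show "\<gamma> ` {1..card A} = A"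
    using assms by simp
qed

lemma has_slope_on_affine_near:
  assumes "has_slope_on f s S" and "open S" and "x \<in> S"
  shows "\<exists>p. affine_near f x p"
proof -
  obtain c where "\<And>y. y \<in> S \<Longrightarrow> f y = s * y + c"
    using assms unfolding has_slope_on_def by blast
  then have "affine_near f x (s, c)"
    using assms unfolding affine_near_def eventually_nhds by auto
  then show ?thesis by blast
qed

lemma has_slope_on_subset: "has_slope_on f s S \<Longrightarrow> T \<subseteq> S \<Longrightarrow> has_slope_on f s T"
  unfolding has_slope_on_def by blast

text \<open>Any point other than an abscissa is interior to a piece and so has a local affine
  formula. The inclusion yields finiteness of the break set.\<close>

lemma breaks_piecewise_linear:
  assumes pl: "piecewise_linear_with f M \<gamma> \<mu>"
  shows "breaks f \<subseteq> \<gamma> ` {1..M}"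
proof
  fix x assume x: "x \<in> breaks f"
  have nb: "x \<notin> S" if "has_slope_on f s S" "open S" for s S
    using has_slope_on_affine_near[OF that] x unfolding breaks_def by blast
  have M: "M \<ge> 1" using pl unfolding piecewise_linear_with_def by blast
  have "has_slope_on f (\<mu> 0) {..<\<gamma> 1}"
    using pl unfolding piecewise_linear_with_def by blast
  from nb[OF this] have ge: "\<gamma> 1 \<le> x" by simp
  \<comment> \<open>The largest index with \<open>\<gamma> i \<le> x\<close> selects the piece
    containing \<open>x\<close>.\<close>
  define I where "I = {i \<in> {1..M}. \<gamma> i \<le> x}"
  have I: "finite I" "1 \<in> I" using M ge unfolding I_def by auto
  define i where "i = Max I"
  have "i \<in> I" unfolding i_def by (rule Max_in) (use I in auto)
  then have i: "1 \<le> i" "i \<le> M" "\<gamma> i \<le> x" unfolding I_def by auto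
  have "x = \<gamma> i"
  proof (rule ccontr)
    assume "x \<noteq> \<gamma> i"
    with i have gt: "\<gamma> i < x" by simp
    show False
    proof (cases "i = M")
      case True
      have "has_slope_on f (\<mu> M) {\<gamma> M..}"
        using pl unfolding piecewise_linear_with_def by blast
      \<comment> \<open>Dropping the left endpoint makes the piece open, as \<open>nb\<close>
        requires.\<close>
      then have "has_slope_on f (\<mu> M) {\<gamma> M<..}"
        by (rule has_slope_on_subset) auto
      from nb[OF this] gt True show False by simp
    next
      case False
      with i have iM: "i < M" by simp
      have "i + 1 \<notin> I"
        using Max_ge[OF I(1), of "i + 1"] unfolding i_def by auto
      then have lt: "x < \<gamma> (i + 1)" using iM unfolding I_def by auto
      have "has_slope_on f (\<mu> i) {\<gamma> i..<\<gamma> (i + 1)}"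
        using pl i iM unfolding piecewise_linear_with_def by simp
      then have "has_slope_on f (\<mu> i) {\<gamma> i<..<\<gamma> (i + 1)}"
        by (rule has_slope_on_subset) auto
      from nb[OF this] gt lt show False by simp
    qed
  qed
  with i show "x \<in> \<gamma> ` {1..M}" by auto
qed

text \<open>Two distinct zeros identify the line with the zero line, which spreads vanishing over
  the whole piece.\<close>

lemma has_slope_on_zero_imp:
  assumes "has_slope_on f s S" and "x \<in> S" "y \<in> S" "x \<noteq> y" and "f x = 0" "f y = 0"
  shows "s = 0" and "z \<in> S \<Longrightarrow> f z = 0"
proof -
  obtain c where c: "\<And>y. y \<in> S \<Longrightarrow> f y = s * y + c"
    using assms(1) unfolding has_slope_on_def by blast
  have "s = 0 \<and> c = 0"
    using affine_coeffs_eqI[of s x c 0 0 y] c[of x] c[of y] assms by simp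
  then show "s = 0" and "z \<in> S \<Longrightarrow> f z = 0" using c by auto
qed

text \<open>For the zero function both slopes adjacent to \<open>\<gamma> 1\<close> would be 0,
  against the change of slope required there.\<close>

lemma class_P_nonzero:
  assumes "class_P f"
  shows "\<exists>x. f x \<noteq> 0"
proof (rule ccontr)
  assume "\<nexists>x. f x \<noteq> 0"
  then have zero: "f x = 0" for x by blast
  obtain M \<gamma> \<mu> where pl: "piecewise_linear_with f M \<gamma> \<mu>"
    using assms unfolding class_P_def by blast
  have M: "M \<ge> 1" and ne: "\<mu> (0 + 1) \<noteq> \<mu> 0"
    using pl unfolding piecewise_linear_with_def by auto
  have "has_slope_on f (\<mu> 0) {..<\<gamma> 1}"
    using pl unfolding piecewise_linear_with_def by blast
  then have 0: "\<mu> 0 = 0"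
    by (rule has_slope_on_zero_imp[where x = "\<gamma> 1 - 1" and y = "\<gamma> 1 - 2"]) (auto simp: zero)
  have "\<mu> 1 = 0"
  proof (cases "M = 1")
    case True
    then have "has_slope_on f (\<mu> 1) {\<gamma> 1..}"
      using pl unfolding piecewise_linear_with_def by blast
    then show ?thesis
      by (rule has_slope_on_zero_imp[where x = "\<gamma> 1" and y = "\<gamma> 1 + 1"]) (auto simp: zero)
  next
    case False
    then have "1 < M" using M by simp
    then have "has_slope_on f (\<mu> 1) {\<gamma> 1..<\<gamma> (1 + 1)}" and lt: "\<gamma> 1 < \<gamma> (1 + 1)"
      using pl unfolding piecewise_linear_with_def by (auto intro: strict_mono_onD)
    from this(1) show ?thesis
      by (rule has_slope_on_zero_imp[where x = "\<gamma> 1" and y = "(\<gamma> 1 + \<gamma> (1 + 1)) / 2"])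
        (use lt in \<open>auto simp: zero\<close>)
  qed
  with 0 ne show False by simp
qed

text \<open>With exactly the breaks as abscissae, every change of slope is genuine. The first piece
  is closed at \<open>\<gamma> 1\<close> because \<open>class_P\<close> asks for a zero at
  \<open>\<gamma> 1\<close> itself.\<close>

lemma piecewise_linear_breaks:
  assumes cont: "continuous_on UNIV f" and fin: "finite (breaks f)" and ne: "breaks f \<noteq> {}"
  obtains M \<gamma> \<mu> where "piecewise_linear_with f M \<gamma> \<mu>" and "has_slope_on f (\<mu> 0) {..\<gamma> 1}"
proof -
  obtain \<gamma> where mono: "strict_mono_on {1..card (breaks f)} \<gamma>"
    and img: "\<gamma> ` {1..card (breaks f)} = breaks f"
    using finite_strict_mono_enumeration[OF fin] by blast
  define M where "M = card (breaks f)"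
  note mono = mono[folded M_def] and img = img[folded M_def]
  have M: "M \<ge> 1" using fin ne by (simp add: M_def Suc_le_eq card_gt_0_iff)
  \<comment> \<open>\<open>G i\<close> and \<open>H i\<close> are the open and the closed
    \<open>i\<close>-th piece; the implications remove the missing bound at \<open>i = 0\<close> and
    at \<open>i = M\<close>.\<close>
  define G where "G i = {x. (1 \<le> i \<longrightarrow> \<gamma> i < x) \<and> (i < M \<longrightarrow> x < \<gamma> (i + 1))}" for i
  define H where "H i = {x. (1 \<le> i \<longrightarrow> \<gamma> i \<le> x) \<and> (i < M \<longrightarrow> x \<le> \<gamma> (i + 1))}" for i
  have le: "\<gamma> i \<le> \<gamma> j" if "1 \<le> i" "i \<le> j" "j \<le> M" for i j
    using strict_mono_onD[OF mono, of i j] that by (cases "i = j") auto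
  have less: "\<gamma> i < \<gamma> (i + 1)" if "1 \<le> i" "i < M" for i
    using strict_mono_onD[OF mono, of i "i + 1"] that by auto
  have disj: "G i \<inter> breaks f = {}" if "i \<le> M" for i
  proof -
    have "\<gamma> j \<notin> G i" if j: "j \<in> {1..M}" for j
    proof (cases "j \<le> i")
      case True
      then show ?thesis using le[of j i] j \<open>i \<le> M\<close> unfolding G_def by auto
    next
      case False
      then show ?thesis using le[of "i + 1" j] j unfolding G_def by auto
    qed
    then show ?thesis unfolding img[symmetric] by blast
  qed
  have conn: "connected (G i)" for i
    by (rule is_interval_connected) (force simp: is_interval_1 G_def)
  have GH: "H i \<subseteq> closure (G i)" if i: "i \<le> M" for i
  proof -
    consider "i = 0" | "i = M" "1 \<le> i" | "1 \<le> i" "i < M" using i by linarith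
    then show ?thesis
    proof cases
      case 1
      then have "H i = {..\<gamma> 1}" "G i = {..<\<gamma> 1}" using M unfolding H_def G_def by auto
      then show ?thesis by simp
    next
      case 2
      then have "H i = {\<gamma> i..}" "G i = {\<gamma> i<..}" unfolding H_def G_def by auto
      then show ?thesis by simp
    next
      case 3
      then have "H i = {\<gamma> i..\<gamma> (i + 1)}" "G i = {\<gamma> i<..<\<gamma> (i + 1)}"
        unfolding H_def G_def by auto
      then show ?thesis using less[OF 3] by simp
    qed
  qed
  \<comment> \<open>Continuity makes the set of agreement with a line closed, so the formula passes
    from \<open>G i\<close> to its closure.\<close>
  have "\<exists>p. \<forall>x\<in>H i. f x = fst p * x + snd p" if i: "i \<le> M" for i
  proof -
    obtain p where p: "\<And>x. x \<in> G i \<Longrightarrow> affine_near f x p"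
      using affine_near_connected[OF conn disj[OF i]] by blast
    have "closed {x. f x = fst p * x + snd p}"
      by (intro closed_Collect_eq cont continuous_intros)
    moreover have "G i \<subseteq> {x. f x = fst p * x + snd p}"
      using p affine_near_value by blast
    ultimately have "H i \<subseteq> {x. f x = fst p * x + snd p}"
      using GH[OF i] closure_minimal by blast
    then show ?thesis by blast
  qed
  then obtain P where P: "\<And>i x. i \<le> M \<Longrightarrow> x \<in> H i \<Longrightarrow> f x = fst (P i) * x + snd (P i)"
    by metis
  have slope: "has_slope_on f (fst (P i)) S" if "i \<le> M" "S \<subseteq> H i" for i S
    using P that unfolding has_slope_on_def by blast
  \<comment> \<open>Adjacent closed pieces share \<open>\<gamma> (i + 1)\<close>. Equal slopes would
    then force equal intercepts, and one line would describe \<open>f\<close> on both sides of a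
    break.\<close>
  have neq: "fst (P (i + 1)) \<noteq> fst (P i)" if i: "i < M" for i
  proof
    let ?x = "\<gamma> (i + 1)"
    assume eq: "fst (P (i + 1)) = fst (P i)"
    have "?x \<in> H i" "?x \<in> H (i + 1)"
      using i less[of i] less[of "i + 1"] unfolding H_def by auto
    then have "snd (P (i + 1)) = snd (P i)"
      using P[of i ?x] P[of "i + 1" ?x] i eq by simp
    with eq have PP: "P (i + 1) = P i" by (simp add: prod_eq_iff)
    \<comment> \<open>The neighbourhood is kept between the abscissae before and after
      \<open>?x\<close>, where they exist, so that it is covered by \<open>H i\<close> and
      \<open>H (i + 1)\<close>.\<close>
    have "\<forall>\<^sub>F y in nhds ?x. 1 \<le> i \<longrightarrow> \<gamma> i < y"
      using eventually_nhds_in_open[of "{\<gamma> i<..}" ?x] less[of i] i by (cases "1 \<le> i") auto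
    moreover have "\<forall>\<^sub>F y in nhds ?x. i + 1 < M \<longrightarrow> y < \<gamma> (i + 1 + 1)"
      using eventually_nhds_in_open[of "{..<\<gamma> (i + 1 + 1)}" ?x] less[of "i + 1"]
      by (cases "i + 1 < M") auto
    ultimately have "affine_near f ?x (P i)"
      unfolding affine_near_def
    proof eventually_elim
      case (elim y)
      then have "y \<in> H i \<or> y \<in> H (i + 1)" unfolding H_def by auto
      then show ?case using P[of i y] P[of "i + 1" y] PP i by auto
    qed
    moreover have "?x \<in> breaks f" unfolding img[symmetric] using i by auto
    ultimately show False unfolding breaks_def by blast
  qed
  show ?thesis
  proof (rule that[of M \<gamma> "\<lambda>i. fst (P i)"])
    show "piecewise_linear_with f M \<gamma> (\<lambda>i. fst (P i))"
      unfolding piecewise_linear_with_def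
    proof (intro conjI ballI allI impI)
      show "has_slope_on f (fst (P 0)) {..<\<gamma> 1}"
        by (rule slope) (auto simp: H_def)
      show "has_slope_on f (fst (P i)) {\<gamma> i..<\<gamma> (i + 1)}" if "i \<in> {1..<M}" for i
        by (rule slope) (use that in \<open>auto simp: H_def\<close>)
      show "has_slope_on f (fst (P M)) {\<gamma> M..}"
        by (rule slope) (auto simp: H_def)
    qed (use M mono neq in auto)
    show "has_slope_on f (fst (P 0)) {..\<gamma> 1}"
      by (rule slope) (auto simp: H_def)
  qed
qed

section \<open>Intrinsic description of the class, and its stability under minima\<close>

text \<open>Being nonzero somewhere replaces \<open>M \<ge> 1\<close>: a function that is affine
  everywhere and vanishes on a left half-line is zero.\<close>

lemma class_P_iff:
  "class_P f \<longleftrightarrow> continuous_on UNIV f \<and> mono f \<and> finite (breaks f) \<and>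
     (\<exists>a. \<forall>x\<le>a. f x = 0) \<and> (\<exists>x. f x \<noteq> 0)"
proof
  assume P: "class_P f"
  then obtain M \<gamma> \<mu> where "piecewise_linear_with f M \<gamma> \<mu>" "\<forall>x\<le>\<gamma> 1. f x = 0"
    and "continuous_on UNIV f" "mono f"
    unfolding class_P_def by blast
  then show "continuous_on UNIV f \<and> mono f \<and> finite (breaks f) \<and>
      (\<exists>a. \<forall>x\<le>a. f x = 0) \<and> (\<exists>x. f x \<noteq> 0)"
    using class_P_nonzero[OF P] finite_subset[OF breaks_piecewise_linear] by blast
next
  assume "continuous_on UNIV f \<and> mono f \<and> finite (breaks f) \<and>
      (\<exists>a. \<forall>x\<le>a. f x = 0) \<and> (\<exists>x. f x \<noteq> 0)"
  then obtain a where f: "continuous_on UNIV f" "mono f" "finite (breaks f)"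
    and a: "\<And>x. x \<le> a \<Longrightarrow> f x = 0" and nz: "\<exists>x. f x \<noteq> 0"
    by blast
  \<comment> \<open>A piece containing a left half-line contains the two zeros
    \<open>min a b\<close> and \<open>min a b - 1\<close>. This extends vanishing from
    \<open>a\<close> up to the first break.\<close>
  have zero: "f z = 0" if "has_slope_on f s S" "z \<in> S" "{..b} \<subseteq> S" for s S b z
    by (rule has_slope_on_zero_imp(2)[OF that(1), of "min a b" "min a b - 1"])
      (use that a in auto)
  have "breaks f \<noteq> {}"
  proof
    assume "breaks f = {}"
    then obtain p where "\<And>x. affine_near f x p"
      using affine_near_connected[of UNIV f] by auto
    then have "has_slope_on f (fst p) UNIV"
      unfolding has_slope_on_def using affine_near_value by blast
    with zero nz show False by blast
  qed
  then obtain M \<gamma> \<mu> where "piecewise_linear_with f M \<gamma> \<mu>" "has_slope_on f (\<mu> 0) {..\<gamma> 1}"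
    using piecewise_linear_breaks f by blast
  with zero f show "class_P f" unfolding class_P_def by blast
qed

theorem lemma4:
  fixes f1 f2 :: "real \<Rightarrow> real"
  assumes "class_P f1" and "class_P f2"
  shows "class_P (\<lambda>x. min (f1 x) (f2 x))"
proof -
  obtain a1 b1 where f1: "continuous_on UNIV f1" "mono f1" "finite (breaks f1)"
    and a1: "\<And>x. x \<le> a1 \<Longrightarrow> f1 x = 0" and b1: "f1 b1 \<noteq> 0"
    using assms(1) unfolding class_P_iff by blast
  obtain a2 b2 where f2: "continuous_on UNIV f2" "mono f2" "finite (breaks f2)"
    and a2: "\<And>x. x \<le> a2 \<Longrightarrow> f2 x = 0" and b2: "f2 b2 \<noteq> 0"
    using assms(2) unfolding class_P_iff by blast
  \<comment> \<open>The minimum of two nonzero functions must be shown nonzero. Monotonicity makes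
    each function positive from its nonzero point onwards, so both are positive at
    \<open>max b1 b2\<close>.\<close>
  have pos: "0 < f y" if "mono f" "\<And>x. x \<le> a \<Longrightarrow> f x = 0" "f b \<noteq> 0" "b \<le> y"
    for f :: "real \<Rightarrow> real" and a b y
    using monoD[OF that(1), of a b] monoD[OF that(1), of b y] that(2)[of a] that(2)[of b] that(3,4)
    by linarith
  have "0 < f1 (max b1 b2)" "0 < f2 (max b1 b2)"
    using pos[OF f1(2) a1 b1] pos[OF f2(2) a2 b2] by simp_all
  then have "min (f1 (max b1 b2)) (f2 (max b1 b2)) \<noteq> 0" by simp
  moreover have "\<forall>x\<le>min a1 a2. min (f1 x) (f2 x) = 0"
    using a1 a2 by simp
  moreover have "mono (\<lambda>x. min (f1 x) (f2 x))"
    using f1(2) f2(2) unfolding mono_def by (meson min.mono)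
  moreover have "continuous_on UNIV (\<lambda>x. min (f1 x) (f2 x))"
    using f1(1) f2(1) by (rule continuous_on_min)
  ultimately show ?thesis
    unfolding class_P_iff using finite_breaks_min[OF f1(3) f2(3)] by blast
qed

end
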